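(* Let $R$ be a commutative ring with identity. The $R$-algebras $(\mathcal W(R),+,\odot)$ and $(\mathcal W(R),+,\boxtimes)$ are isomorphic; an explicit isomorphism is $\psi(\mathbf a)=\mathbf a\star\mathbf e$, where $\mathbf e=((-1)^n)_{n\ge0}$.
   Context: $\mathcal W(R)$ is the set of linear recurrent sequences $(a_n)_{n\ge0}$ in $R$, i.e. sequences for which there exist $N\ge0$ and $h_1,\dots,h_N\in R$ with $a_n=\sum_{i=1}^{N}h_ia_{n-i}$ for all $n\ge N$. Operations: componentwise sum $(\mathbf a+\mathbf b)_n=a_n+b_n$; Hadamard product $(\mathbf a\odot\mathbf b)_n=a_nb_n$; Hurwitz product $(\mathbf a\star\mathbf b)_n=\sum_{i=0}^n\binom{n}{i}a_ib_{n-i}$; Newton product $(\mathbf a\boxtimes\mathbf b)_n=\sum_{i=0}^n\sum_{j=0}^i\binom{n}{i}\binom{i}{j}a_ib_{n-j}$. *)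

theory Defs
  imports "HOL-Algebra.Module" "HOL-Algebra.QuotRing"
begin

(* The order N = 0 is allowed and gives only the zero sequence (empty sum).
   Since i \<le> N \<le> n in the recurrence, the index n - i is never truncated. *)
definition lin_rec_seqs :: "('a, 'm) ring_scheme \<Rightarrow> (nat \<Rightarrow> 'a) set" where
  "lin_rec_seqs R = {a. (\<forall>n. a n \<in> carrier R) \<and>
     (\<exists>(N::nat) h. (\<forall>i\<in>{1..N}. h i \<in> carrier R) \<and>
        (\<forall>n\<ge>N. a n = (\<Oplus>\<^bsub>R\<^esub>i\<in>{1..N}. h i \<otimes>\<^bsub>R\<^esub> a (n - i))))}"

definition seq_add :: "('a, 'm) ring_scheme \<Rightarrow> (nat \<Rightarrow> 'a) \<Rightarrow> (nat \<Rightarrow> 'a) \<Rightarrow> nat \<Rightarrow> 'a" where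
  "seq_add R a b = (\<lambda>n. a n \<oplus>\<^bsub>R\<^esub> b n)"

definition seq_smult :: "('a, 'm) ring_scheme \<Rightarrow> 'a \<Rightarrow> (nat \<Rightarrow> 'a) \<Rightarrow> nat \<Rightarrow> 'a" where
  "seq_smult R r a = (\<lambda>n. r \<otimes>\<^bsub>R\<^esub> a n)"

definition hadamard :: "('a, 'm) ring_scheme \<Rightarrow> (nat \<Rightarrow> 'a) \<Rightarrow> (nat \<Rightarrow> 'a) \<Rightarrow> nat \<Rightarrow> 'a" where
  "hadamard R a b = (\<lambda>n. a n \<otimes>\<^bsub>R\<^esub> b n)"

definition hurwitz :: "('a, 'm) ring_scheme \<Rightarrow> (nat \<Rightarrow> 'a) \<Rightarrow> (nat \<Rightarrow> 'a) \<Rightarrow> nat \<Rightarrow> 'a" where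
  "hurwitz R a b = (\<lambda>n. \<Oplus>\<^bsub>R\<^esub>i\<in>{0..n}. [(n choose i)] \<cdot>\<^bsub>R\<^esub> (a i \<otimes>\<^bsub>R\<^esub> b (n - i)))"

definition newton :: "('a, 'm) ring_scheme \<Rightarrow> (nat \<Rightarrow> 'a) \<Rightarrow> (nat \<Rightarrow> 'a) \<Rightarrow> nat \<Rightarrow> 'a" where
  "newton R a b = (\<lambda>n. \<Oplus>\<^bsub>R\<^esub>i\<in>{0..n}. \<Oplus>\<^bsub>R\<^esub>j\<in>{0..i}.
     [((n choose i) * (i choose j))] \<cdot>\<^bsub>R\<^esub> (a i \<otimes>\<^bsub>R\<^esub> b (n - j)))"

definition hadamard_algebra :: "('a, 'm) ring_scheme \<Rightarrow> ('a, nat \<Rightarrow> 'a) module" where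
  "hadamard_algebra R =
     \<lparr>carrier = lin_rec_seqs R, monoid.mult = hadamard R, one = (\<lambda>n. \<one>\<^bsub>R\<^esub>),
      zero = (\<lambda>n. \<zero>\<^bsub>R\<^esub>), add = seq_add R, smult = seq_smult R\<rparr>"

(* The unit of the Newton product is (1, 0, 0, ...). *)
definition newton_algebra :: "('a, 'm) ring_scheme \<Rightarrow> ('a, nat \<Rightarrow> 'a) module" where
  "newton_algebra R =
     \<lparr>carrier = lin_rec_seqs R, monoid.mult = newton R,
      one = (\<lambda>n. if n = 0 then \<one>\<^bsub>R\<^esub> else \<zero>\<^bsub>R\<^esub>),
      zero = (\<lambda>n. \<zero>\<^bsub>R\<^esub>), add = seq_add R, smult = seq_smult R\<rparr>"

(* HOL-Algebra has no R-linear version of ring_iso; ring_iso already includes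
   preservation of the unit. *)
definition algebra_iso ::
  "('a, 'm) ring_scheme \<Rightarrow> ('a, 'b, 'p) module_scheme \<Rightarrow> ('a, 'c, 'q) module_scheme \<Rightarrow> ('b \<Rightarrow> 'c) set"
  where
  "algebra_iso R A B = {f \<in> ring_iso A B.
     \<forall>r\<in>carrier R. \<forall>x\<in>carrier A. f (r \<odot>\<^bsub>A\<^esub> x) = r \<odot>\<^bsub>B\<^esub> f x}"

definition algebras_isomorphic ::
  "('a, 'm) ring_scheme \<Rightarrow> ('a, 'b, 'p) module_scheme \<Rightarrow> ('a, 'c, 'q) module_scheme \<Rightarrow> bool"
  where
  "algebras_isomorphic R A B \<longleftrightarrow> algebra R A \<and> algebra R B \<and> algebra_iso R A B \<noteq> {}"

definition alt_seq :: "('a, 'm) ring_scheme \<Rightarrow> nat \<Rightarrow> 'a" where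
  "alt_seq R = (\<lambda>n. (\<ominus>\<^bsub>R\<^esub> \<one>\<^bsub>R\<^esub>) [^]\<^bsub>R\<^esub> n)"

end

theory Submission
  imports Defs
begin

text \<open>Let \<open>E\<close> be the shift. Closure of the linear recurrent sequences under all operations comes
  from one criterion: a sequence is linear recurrent iff it lies in a finitely generated
  \<open>R\<close>-module of sequences stable under \<open>E\<close>. The hard direction is the Cayley--Hamilton theorem;
  it is obtained here by fraction-free elimination in a square system of polynomials in \<open>E\<close>
  whose diagonal entries are monic of degree \<open>d\<close> and whose other entries have degree below \<open>d\<close>.

  The map \<open>\<psi>\<close> is the Hurwitz product with \<open>(-1)\<^sup>n\<close>, inverted by the Hurwitz product with the
  constant sequence \<open>1\<close>. Since \<open>E\<close> is a derivation for the Hurwitz product,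
  \<open>\<psi>\<close> turns the forward difference \<open>\<Delta> = E - 1\<close> into \<open>E\<close>. The Leibniz rule
  \<open>\<Delta>(ab) = a \<Delta>b + \<Delta>a \<Delta>b + \<Delta>a b\<close> becomes exactly the recursion that Pascal's rule gives
  for the Newton product, so \<open>\<psi>\<close> is multiplicative by induction on the index.\<close>

context cring
begin

section \<open>Polynomials in the shift\<close>

definition seqs :: "(nat \<Rightarrow> 'a) set" where
  "seqs = {a. \<forall>n. a n \<in> carrier R}"

lemma seqsI [intro!]: "(\<And>n. a n \<in> carrier R) \<Longrightarrow> a \<in> seqs"
  by (simp add: seqs_def)

lemma seqs_closed [simp]: "a \<in> seqs \<Longrightarrow> a n \<in> carrier R"
  by (simp add: seqs_def)

text \<open>A polynomial is represented by the operator it induces, so multiplication becomes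
  composition. Only the values on \<open>seqs\<close> are constrained.\<close>

definition shift_poly :: "nat \<Rightarrow> ((nat \<Rightarrow> 'a) \<Rightarrow> nat \<Rightarrow> 'a) \<Rightarrow> bool" where
  "shift_poly d T \<longleftrightarrow> (\<exists>c\<in>seqs. \<forall>a\<in>seqs. \<forall>n. T a n = (\<Oplus>i\<in>{..<d}. c i \<otimes> a (n + i)))"

text \<open>Here \<open>d\<close> is a strict degree bound for \<^term>\<open>shift_poly\<close>, but the exact degree for the monic
  polynomials.\<close>

definition monic_shift_poly :: "nat \<Rightarrow> ((nat \<Rightarrow> 'a) \<Rightarrow> nat \<Rightarrow> 'a) \<Rightarrow> bool" where
  "monic_shift_poly d T \<longleftrightarrow>
     (\<exists>S. shift_poly d S \<and> (\<forall>a\<in>seqs. \<forall>n. T a n = a (n + d) \<oplus> S a n))"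

lemma finsum_lessThan_Suc:
  "f \<in> UNIV \<rightarrow> carrier R \<Longrightarrow> (\<Oplus>i\<in>{..<Suc d}. f i) = f d \<oplus> (\<Oplus>i\<in>{..<d}. f i)"
  by (simp add: lessThan_Suc Pi_iff)

lemma finsum_lessThan_Suc2:
  assumes "f \<in> UNIV \<rightarrow> carrier R"
  shows "(\<Oplus>i\<in>{..<Suc d}. f i) = f 0 \<oplus> (\<Oplus>i\<in>{..<d}. f (Suc i))"
proof (induction d)
  case 0
  then show ?case using assms by (simp add: finsum_lessThan_Suc)
next
  case (Suc d)
  have "(\<Oplus>i\<in>{..<d}. f (Suc i)) \<in> carrier R" using assms by (simp add: Pi_iff)
  with Suc show ?case
    using assms finsum_lessThan_Suc[OF assms, of "Suc d"]
      finsum_lessThan_Suc[of "\<lambda>i. f (Suc i)" d] a_lcomm by (simp add: Pi_iff)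
qed

section \<open>Arithmetic of polynomials in the shift\<close>

lemma shift_poly_closed: "shift_poly d T \<Longrightarrow> a \<in> seqs \<Longrightarrow> T a \<in> seqs"
  unfolding shift_poly_def by (auto intro!: seqsI finsum_closed)

lemma shift_poly_0_iff: "shift_poly 0 T \<longleftrightarrow> (\<forall>a\<in>seqs. \<forall>n. T a n = \<zero>)"
  unfolding shift_poly_def by auto

text \<open>Splits off the leading coefficient, so that sums, multiples, products and commutation
  are handled by induction on the degree bound instead of by coefficient sums.\<close>

lemma shift_poly_Suc_iff:
  "shift_poly (Suc d) T \<longleftrightarrow>
     (\<exists>S. \<exists>c\<in>carrier R. shift_poly d S \<and> (\<forall>a\<in>seqs. \<forall>n. T a n = c \<otimes> a (n + d) \<oplus> S a n))"
proof
  assume "shift_poly (Suc d) T"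
  then obtain c where c: "c \<in> seqs"
    and T: "\<And>a n. a \<in> seqs \<Longrightarrow> T a n = (\<Oplus>i\<in>{..<Suc d}. c i \<otimes> a (n + i))"
    unfolding shift_poly_def by blast
  have "T a n = c d \<otimes> a (n + d) \<oplus> (\<Oplus>i\<in>{..<d}. c i \<otimes> a (n + i))" if "a \<in> seqs" for a n
    using T[OF that] c that finsum_lessThan_Suc[of "\<lambda>i. c i \<otimes> a (n + i)" d] by simp
  then show "\<exists>S. \<exists>c\<in>carrier R. shift_poly d S \<and>
      (\<forall>a\<in>seqs. \<forall>n. T a n = c \<otimes> a (n + d) \<oplus> S a n)"
    using c by (intro exI[of _ "\<lambda>a n. \<Oplus>i\<in>{..<d}. c i \<otimes> a (n + i)"] bexI[of _ "c d"])
      (auto simp: shift_poly_def)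
next
  assume "\<exists>S. \<exists>c\<in>carrier R. shift_poly d S \<and>
      (\<forall>a\<in>seqs. \<forall>n. T a n = c \<otimes> a (n + d) \<oplus> S a n)"
  then obtain S c c' where c: "c \<in> carrier R" "c' \<in> seqs"
    and S: "\<And>a n. a \<in> seqs \<Longrightarrow> S a n = (\<Oplus>i\<in>{..<d}. c' i \<otimes> a (n + i))"
    and T: "\<And>a n. a \<in> seqs \<Longrightarrow> T a n = c \<otimes> a (n + d) \<oplus> S a n"
    unfolding shift_poly_def by blast
  have "T a n = (\<Oplus>i\<in>{..<Suc d}. (c'(d := c)) i \<otimes> a (n + i))" if a: "a \<in> seqs" for a n
  proof -
    have "(\<Oplus>i\<in>{..<d}. c' i \<otimes> a (n + i)) = (\<Oplus>i\<in>{..<d}. (c'(d := c)) i \<otimes> a (n + i))"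
      using a c by (intro finsum_cong') auto
    then show ?thesis
      using T S a c finsum_lessThan_Suc[of "\<lambda>i. (c'(d := c)) i \<otimes> a (n + i)" d] by simp
  qed
  moreover have "c'(d := c) \<in> seqs" using c by auto
  ultimately show "shift_poly (Suc d) T" unfolding shift_poly_def by blast
qed

lemma shift_poly_cong:
  assumes "shift_poly d S" "\<And>a n. a \<in> seqs \<Longrightarrow> T a n = S a n"
  shows "shift_poly d T"
  using assms unfolding shift_poly_def by auto

lemma shift_poly_Suc: "shift_poly d T \<Longrightarrow> shift_poly (Suc d) T"
  unfolding shift_poly_Suc_iff
  by (intro exI[of _ T] bexI[of _ \<zero>]) (auto simp: seqs_closed[OF shift_poly_closed])

lemma shift_poly_mono:
  assumes "shift_poly d T" "d \<le> e"
  shows "shift_poly e T"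
  using assms(2,1) by (induction rule: dec_induct) (auto intro: shift_poly_Suc)

lemma shift_poly_add:
  "shift_poly d S \<Longrightarrow> shift_poly d T \<Longrightarrow> shift_poly d (\<lambda>a n. S a n \<oplus> T a n)"
proof (induction d arbitrary: S T)
  case 0
  then show ?case by (simp add: shift_poly_0_iff)
next
  case (Suc d)
  obtain S' c where S: "c \<in> carrier R" "shift_poly d S'"
    "\<And>a n. a \<in> seqs \<Longrightarrow> S a n = c \<otimes> a (n + d) \<oplus> S' a n"
    using Suc.prems(1) unfolding shift_poly_Suc_iff by blast
  obtain T' c' where T: "c' \<in> carrier R" "shift_poly d T'"
    "\<And>a n. a \<in> seqs \<Longrightarrow> T a n = c' \<otimes> a (n + d) \<oplus> T' a n"
    using Suc.prems(2) unfolding shift_poly_Suc_iff by blast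
  have "S a n \<oplus> T a n = (c \<oplus> c') \<otimes> a (n + d) \<oplus> (S' a n \<oplus> T' a n)" if a: "a \<in> seqs" for a n
  proof -
    have "a (n + d) \<in> carrier R" "S' a n \<in> carrier R" "T' a n \<in> carrier R"
      using a shift_poly_closed[OF S(2)] shift_poly_closed[OF T(2)] by auto
    with S(1) T(1) show ?thesis unfolding S(3)[OF a] T(3)[OF a]
      by (simp add: l_distr a_ac)
  qed
  with Suc.IH[OF S(2) T(2)] S(1) T(1) show ?case
    unfolding shift_poly_Suc_iff
    by (intro exI[of _ "\<lambda>a n. S' a n \<oplus> T' a n"] bexI[of _ "c \<oplus> c'"]) auto
qed

lemma shift_poly_smult:
  "shift_poly d T \<Longrightarrow> r \<in> carrier R \<Longrightarrow> shift_poly d (\<lambda>a n. r \<otimes> T a n)"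
proof (induction d arbitrary: T)
  case 0
  then show ?case by (simp add: shift_poly_0_iff)
next
  case (Suc d)
  obtain T' c where T: "c \<in> carrier R" "shift_poly d T'"
    "\<And>a n. a \<in> seqs \<Longrightarrow> T a n = c \<otimes> a (n + d) \<oplus> T' a n"
    using Suc.prems(1) unfolding shift_poly_Suc_iff by blast
  have "r \<otimes> T a n = (r \<otimes> c) \<otimes> a (n + d) \<oplus> r \<otimes> T' a n" if a: "a \<in> seqs" for a n
  proof -
    have "a (n + d) \<in> carrier R" "T' a n \<in> carrier R"
      using a shift_poly_closed[OF T(2)] by auto
    with T(1) Suc.prems(2) show ?thesis unfolding T(3)[OF a]
      by (simp add: r_distr m_assoc)
  qed
  with Suc.IH[OF T(2)] T(1) Suc.prems(2) show ?case
    unfolding shift_poly_Suc_iff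
    by (intro exI[of _ "\<lambda>a n. r \<otimes> T' a n"] bexI[of _ "r \<otimes> c"]) auto
qed

lemma shift_poly_uminus: "shift_poly d T \<Longrightarrow> shift_poly d (\<lambda>a n. \<ominus> T a n)"
  by (rule shift_poly_cong[OF shift_poly_smult[of d T "\<ominus> \<one>"]])
    (auto simp: l_minus seqs_closed[OF shift_poly_closed])

lemma shift_poly_minus:
  "shift_poly d S \<Longrightarrow> shift_poly d T \<Longrightarrow> shift_poly d (\<lambda>a n. S a n \<ominus> T a n)"
  unfolding a_minus_def by (intro shift_poly_add shift_poly_uminus)

lemma shift_poly_shift1:
  assumes "shift_poly d T"
  shows "shift_poly (Suc d) (\<lambda>a n. T a (Suc n))"
proof -
  obtain c where c: "c \<in> seqs"
    and T: "\<And>a n. a \<in> seqs \<Longrightarrow> T a n = (\<Oplus>i\<in>{..<d}. c i \<otimes> a (n + i))"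
    using assms unfolding shift_poly_def by blast
  \<comment> \<open>Multiplication by \<open>E\<close> moves each coefficient up one place;
    \<open>case_nat \<zero> c\<close> fills the vacated constant term.\<close>
  have "T a (Suc n) = (\<Oplus>i\<in>{..<Suc d}. case_nat \<zero> c i \<otimes> a (n + i))" if "a \<in> seqs" for a n
  proof (subst finsum_lessThan_Suc2)
    show "(\<lambda>i. case_nat \<zero> c i \<otimes> a (n + i)) \<in> UNIV \<rightarrow> carrier R"
      using c that by (auto split: nat.split)
    show "T a (Suc n) = case_nat \<zero> c 0 \<otimes> a (n + 0) \<oplus>
        (\<Oplus>i\<in>{..<d}. case_nat \<zero> c (Suc i) \<otimes> a (n + Suc i))"
      using T c that by (simp add: Pi_iff)
  qed
  moreover have "case_nat \<zero> c \<in> seqs" using c by (auto split: nat.split)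
  ultimately show ?thesis unfolding shift_poly_def by blast
qed

lemma shift_poly_shift: "shift_poly d T \<Longrightarrow> shift_poly (d + k) (\<lambda>a n. T a (n + k))"
  by (induction k) (auto dest: shift_poly_shift1)

text \<open>Both bounds are strict, so degrees at most \<open>d - 1\<close> and \<open>e - 1\<close>
  add up to the bound \<open>d + e - 1\<close>. The saved unit matters in the elimination, where
  bounds \<open>Suc d\<close> and \<open>d\<close> must combine to \<open>d + d\<close>.\<close>

lemma shift_poly_comp:
  "shift_poly d S \<Longrightarrow> shift_poly e T \<Longrightarrow> shift_poly (d + e - 1) (\<lambda>a. S (T a))"
proof (induction d arbitrary: S)
  case 0
  have "shift_poly 0 (\<lambda>a. S (T a))"
    using 0 shift_poly_closed[of e T] by (simp add: shift_poly_0_iff)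
  then show ?case by (rule shift_poly_mono) simp
next
  case (Suc d)
  obtain S' c where S: "c \<in> carrier R" "shift_poly d S'"
    "\<And>a n. a \<in> seqs \<Longrightarrow> S a n = c \<otimes> a (n + d) \<oplus> S' a n"
    using Suc.prems(1) unfolding shift_poly_Suc_iff by blast
  have "shift_poly (e + d) (\<lambda>a n. c \<otimes> T a (n + d))"
    using Suc.prems(2) S(1) by (intro shift_poly_smult shift_poly_shift)
  moreover have "shift_poly (e + d) (\<lambda>a n. S' (T a) n)"
    using Suc.IH[OF S(2) Suc.prems(2)] by (rule shift_poly_mono) simp
  ultimately have "shift_poly (e + d) (\<lambda>a n. c \<otimes> T a (n + d) \<oplus> S' (T a) n)"
    by (rule shift_poly_add)
  then have "shift_poly (e + d) (\<lambda>a. S (T a))"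
    by (rule shift_poly_cong) (use S(3) shift_poly_closed[OF Suc.prems(2)] in blast)
  then show ?case by (simp add: add.commute)
qed

section \<open>Polynomials in the shift as commuting linear operators\<close>

lemma shift_poly_linear:
  assumes "shift_poly d T" "a \<in> seqs"
  shows "b \<in> seqs \<Longrightarrow> T (\<lambda>n. a n \<oplus> b n) n = T a n \<oplus> T b n"
    and "r \<in> carrier R \<Longrightarrow> T (\<lambda>n. r \<otimes> a n) n = r \<otimes> T a n"
    and "T (\<lambda>n. a (n + k)) n = T a (n + k)"
proof -
  obtain c where c: "c \<in> seqs"
    and T: "\<And>a n. a \<in> seqs \<Longrightarrow> T a n = (\<Oplus>i\<in>{..<d}. c i \<otimes> a (n + i))"
    using assms(1) unfolding shift_poly_def by blast
  show "T (\<lambda>n. a n \<oplus> b n) n = T a n \<oplus> T b n" if b: "b \<in> seqs"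
  proof -
    have "T (\<lambda>n. a n \<oplus> b n) n = (\<Oplus>i\<in>{..<d}. c i \<otimes> (a (n + i) \<oplus> b (n + i)))"
      using assms b by (subst T) auto
    also have "\<dots> = (\<Oplus>i\<in>{..<d}. c i \<otimes> a (n + i) \<oplus> c i \<otimes> b (n + i))"
      using assms b c by (intro finsum_cong') (auto simp: r_distr)
    finally show ?thesis using assms b c T by (simp add: finsum_addf Pi_iff)
  qed
  show "T (\<lambda>n. r \<otimes> a n) n = r \<otimes> T a n" if r: "r \<in> carrier R"
  proof -
    have "T (\<lambda>n. r \<otimes> a n) n = (\<Oplus>i\<in>{..<d}. c i \<otimes> (r \<otimes> a (n + i)))"
      using assms r by (subst T) auto
    also have "\<dots> = (\<Oplus>i\<in>{..<d}. r \<otimes> (c i \<otimes> a (n + i)))"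
      using assms r c by (intro finsum_cong') (auto simp: m_lcomm)
    finally show ?thesis using assms r c T by (simp add: finsum_rdistr Pi_iff)
  qed
  have "(\<lambda>n. a (n + k)) \<in> seqs" using assms by auto
  then show "T (\<lambda>n. a (n + k)) n = T a (n + k)"
    using assms T by (simp add: ac_simps)
qed

text \<open>\<open>T\<close> is linear and commutes with \<open>E\<close>, so it can be moved
  through \<open>S\<close> one leading term at a time.\<close>

lemma shift_poly_comm:
  assumes "shift_poly d S" "shift_poly e T" "a \<in> seqs"
  shows "S (T a) n = T (S a) n"
  using assms(1)
proof (induction d arbitrary: S n)
  case 0
  \<comment> \<open>The zero sequence is written as a multiple of \<open>a\<close>, so that
    homogeneity of \<open>T\<close> evaluates it.\<close>
  have "T (\<lambda>n. \<zero> \<otimes> a n) n = \<zero> \<otimes> T a n"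
    using assms by (intro shift_poly_linear) auto
  moreover have "(\<lambda>n. \<zero> \<otimes> a n) = S a" using 0 assms by (auto simp: shift_poly_0_iff)
  ultimately show ?case
    using 0 assms shift_poly_closed[of e T a] by (simp add: shift_poly_0_iff)
next
  case (Suc d)
  obtain S' c where S: "c \<in> carrier R" "shift_poly d S'"
    "\<And>a n. a \<in> seqs \<Longrightarrow> S a n = c \<otimes> a (n + d) \<oplus> S' a n"
    using Suc.prems(1) unfolding shift_poly_Suc_iff by blast
  have Ea: "(\<lambda>n. a (n + d)) \<in> seqs" and cEa: "(\<lambda>n. c \<otimes> a (n + d)) \<in> seqs"
    using assms(3) S(1) by auto
  have "T (S a) n = T (\<lambda>n. c \<otimes> a (n + d) \<oplus> S' a n) n"
    using S(3)[OF assms(3)] by presburger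
  also have "\<dots> = T (\<lambda>n. c \<otimes> a (n + d)) n \<oplus> T (S' a) n"
    using shift_poly_linear(1)[OF assms(2) cEa shift_poly_closed[OF S(2) assms(3)]] .
  also have "\<dots> = c \<otimes> T a (n + d) \<oplus> S' (T a) n"
    using shift_poly_linear(2)[OF assms(2) Ea S(1)] shift_poly_linear(3)[OF assms(2,3)]
      Suc.IH[OF S(2)] by simp
  also have "\<dots> = S (T a) n" using S(3) shift_poly_closed[OF assms(2,3)] by simp
  finally show ?case ..
qed

lemma shift_poly_uminus_arg:
  assumes "shift_poly d T" "a \<in> seqs"
  shows "T (\<lambda>n. \<ominus> a n) n = \<ominus> T a n"
proof -
  have "T (\<lambda>n. \<ominus> \<one> \<otimes> a n) n = \<ominus> \<one> \<otimes> T a n"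
    using assms by (intro shift_poly_linear) auto
  moreover have "(\<lambda>n. \<ominus> \<one> \<otimes> a n) = (\<lambda>n. \<ominus> a n)" using assms by (auto simp: l_minus)
  ultimately show ?thesis using assms shift_poly_closed[of d T a] by (simp add: l_minus)
qed

lemma shift_poly_finsum:
  assumes T: "shift_poly d T" and "finite J" "\<And>j. j \<in> J \<Longrightarrow> f j \<in> seqs"
  shows "T (\<lambda>n. \<Oplus>j\<in>J. f j n) n = (\<Oplus>j\<in>J. T (f j) n)"
  using assms(2,3)
proof (induction J rule: finite_induct)
  case empty
  have "T (\<lambda>n. \<zero> \<otimes> \<zero>) n = \<zero> \<otimes> T (\<lambda>n. \<zero>) n"
    using T by (intro shift_poly_linear) auto
  then show ?case using seqs_closed[OF shift_poly_closed[OF T seqsI], of "\<lambda>n. \<zero>"] by simp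
next
  case (insert j J)
  have "(\<Oplus>j\<in>insert j J. f j n) = f j n \<oplus> (\<Oplus>j\<in>J. f j n)" for n
    using insert by (intro finsum_insert) auto
  moreover have "(\<Oplus>j\<in>insert j J. T (f j) n) = T (f j) n \<oplus> (\<Oplus>j\<in>J. T (f j) n)"
    using insert seqs_closed[OF shift_poly_closed[OF T]] by (intro finsum_insert) auto
  moreover have "(\<lambda>n. \<Oplus>j\<in>J. f j n) \<in> seqs" using insert.prems by (intro seqsI finsum_closed) auto
  ultimately show ?case
    using insert shift_poly_linear(1)[OF T, of "f j" "\<lambda>n. \<Oplus>j\<in>J. f j n"] by simp
qed

section \<open>Monic polynomials and elimination\<close>

lemma monic_shift_poly_imp_shift_poly:
  assumes "monic_shift_poly d T"
  shows "shift_poly (Suc d) T"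
proof -
  obtain S where "shift_poly d S" "\<forall>a\<in>seqs. \<forall>n. T a n = \<one> \<otimes> a (n + d) \<oplus> S a n"
    using assms unfolding monic_shift_poly_def by auto
  then show ?thesis unfolding shift_poly_Suc_iff by blast
qed

lemma monic_shift_poly_minus:
  assumes "monic_shift_poly d T" "shift_poly d S"
  shows "monic_shift_poly d (\<lambda>a n. T a n \<ominus> S a n)"
proof -
  obtain T' where T: "shift_poly d T'" "\<And>a n. a \<in> seqs \<Longrightarrow> T a n = a (n + d) \<oplus> T' a n"
    using assms(1) unfolding monic_shift_poly_def by auto
  have "T a n \<ominus> S a n = a (n + d) \<oplus> (T' a n \<ominus> S a n)" if a: "a \<in> seqs" for a n
    using a T(2)[OF a] seqs_closed[OF a] seqs_closed[OF shift_poly_closed[OF T(1) a]]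
      seqs_closed[OF shift_poly_closed[OF assms(2) a]] by (simp add: a_minus_def a_assoc)
  with shift_poly_minus[OF T(1) assms(2)] show ?thesis
    unfolding monic_shift_poly_def by blast
qed

lemma monic_shift_poly_comp:
  assumes "monic_shift_poly d S" "monic_shift_poly e T"
  shows "monic_shift_poly (d + e) (\<lambda>a. S (T a))"
proof -
  obtain S' where S: "shift_poly d S'" "\<And>a n. a \<in> seqs \<Longrightarrow> S a n = a (n + d) \<oplus> S' a n"
    using assms(1) unfolding monic_shift_poly_def by auto
  obtain T' where T: "shift_poly e T'" "\<And>a n. a \<in> seqs \<Longrightarrow> T a n = a (n + e) \<oplus> T' a n"
    using assms(2) unfolding monic_shift_poly_def by auto
  note Top = monic_shift_poly_imp_shift_poly[OF assms(2)]
  \<comment> \<open>The product is \<open>E^(d + e)\<close> plus \<open>T' E^d + S' T\<close>. As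
    \<open>T\<close> has strict bound \<open>Suc e\<close>, the term \<open>S' T\<close> has bound
    \<open>d + Suc e - 1 = d + e\<close>.\<close>
  have "shift_poly (d + e) (\<lambda>a n. T' a (n + d) \<oplus> S' (T a) n)"
    using shift_poly_shift[OF T(1), of d] shift_poly_comp[OF S(1) Top]
    by (intro shift_poly_add) (auto simp: add.commute)
  moreover have "S (T a) n = a (n + (d + e)) \<oplus> (T' a (n + d) \<oplus> S' (T a) n)"
    if a: "a \<in> seqs" for a n
    using S(2)[OF shift_poly_closed[OF Top a]] T(2)[OF a] seqs_closed[OF a]
      seqs_closed[OF shift_poly_closed[OF T(1) a]]
      seqs_closed[OF shift_poly_closed[OF S(1) shift_poly_closed[OF Top a]]]
    by (simp add: a_assoc add.assoc)
  ultimately show ?thesis unfolding monic_shift_poly_def by blast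
qed

text \<open>One unknown \<open>k\<close> is eliminated at a time: row \<open>i\<close> becomes \<open>A k k\<close> times row \<open>i\<close> minus
  \<open>A i k\<close> times row \<open>k\<close>, which doubles the degree \<open>d\<close> but keeps the diagonal monic of dominant
  degree.\<close>

lemma shift_poly_elimination:
  assumes "finite F" "i0 \<notin> F" "\<And>i. i \<in> insert i0 F \<Longrightarrow> e i \<in> seqs"
    and "\<And>i. i \<in> insert i0 F \<Longrightarrow> monic_shift_poly d (A i i)"
    and "\<And>i j. i \<in> insert i0 F \<Longrightarrow> j \<in> insert i0 F \<Longrightarrow> i \<noteq> j \<Longrightarrow> shift_poly d (A i j)"
    and "\<And>i n. i \<in> insert i0 F \<Longrightarrow> (\<Oplus>j\<in>insert i0 F. A i j (e j) n) = \<zero>"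
  shows "\<exists>d T. monic_shift_poly d T \<and> (\<forall>n. T (e i0) n = \<zero>)"
  using assms
\<comment> \<open>Each elimination produces a new system, so \<open>d\<close> and \<open>A\<close>
  vary. Keeping \<open>i0\<close> outside \<open>F\<close> makes it the unknown that
  survives.\<close>
proof (induction F arbitrary: d A rule: finite_induct)
  case empty
  have "A i0 i0 (e i0) \<in> seqs"
    using shift_poly_closed[OF monic_shift_poly_imp_shift_poly[OF empty(3)[of i0]] empty(2)]
    by simp
  then have "A i0 i0 (e i0) n = \<zero>" for n
    using empty(5)[of i0 n] by simp
  with empty(3)[of i0] show ?case by blast
next
  case (insert k F)
  define I where "I = insert i0 F"
  have kI: "k \<notin> I" and finI: "finite I" and I: "insert i0 (insert k F) = insert k I"
    using insert unfolding I_def by auto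
  note e = insert.prems(2)[unfolded I] and mon = insert.prems(3)[unfolded I]
    and low = insert.prems(4)[unfolded I] and eq = insert.prems(5)[unfolded I]
  have op: "shift_poly (Suc d) (A i j)" if "i \<in> insert k I" "j \<in> insert k I" for i j
    using that low mon monic_shift_poly_imp_shift_poly shift_poly_Suc by (cases "i = j") auto
  have cl: "A i j (e l) \<in> seqs" if "i \<in> insert k I" "j \<in> insert k I" "l \<in> insert k I" for i j l
    using shift_poly_closed[OF op[OF that(1,2)] e[OF that(3)]] .
  define B where "B = (\<lambda>i j a n. A k k (A i j a) n \<ominus> A i k (A k j a) n)"
  \<comment> \<open>Both factors are off the diagonal because \<open>k\<close> is not in
    \<open>I\<close>; hence subtracting their product cannot disturb the leading term of degree
    \<open>d + d\<close>.\<close>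
  have corr: "shift_poly (d + d) (\<lambda>a. A i k (A k j a))" if "i \<in> I" "j \<in> I" for i j
  proof -
    have "i \<noteq> k" "k \<noteq> j" using that kI by auto
    with that show ?thesis
      by (intro shift_poly_mono[OF shift_poly_comp[OF low low]]) auto
  qed
  show ?case
  proof (rule insert.IH[where d = "d + d" and A = B])
    show "i0 \<notin> F" using insert by simp
    fix i assume "i \<in> insert i0 F"
    then have i: "i \<in> I" by (simp add: I_def)
    then show "e i \<in> seqs" using e by simp
    show "monic_shift_poly (d + d) (B i i)" unfolding B_def
      using i by (intro monic_shift_poly_minus monic_shift_poly_comp corr mon) auto
    fix n
    \<comment> \<open>Row \<open>l\<close> is solved for its summand in column \<open>k\<close>,
      which trades a sum over \<open>I\<close> for a single term in \<open>e k\<close>.\<close>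
    have solve: "(\<lambda>n. \<Oplus>j\<in>I. A l j (e j) n) = (\<lambda>n. \<ominus> A l k (e k) n)" if l: "l \<in> insert k I" for l
    proof
      fix n
      have cl': "A l k (e k) n \<in> carrier R" "(\<lambda>j. A l j (e j) n) \<in> I \<rightarrow> carrier R"
        using l by (auto intro!: seqs_closed[OF cl])
      have "\<zero> = A l k (e k) n \<oplus> (\<Oplus>j\<in>I. A l j (e j) n)"
        using eq[OF l, of n] finsum_insert[OF finI kI cl'(2,1)] by simp
      then show "(\<Oplus>j\<in>I. A l j (e j) n) = \<ominus> A l k (e k) n"
        using cl' by (intro sum_zero_eq_neg) (auto simp: a_comm)
    qed
    have part: "(\<Oplus>j\<in>I. A m l (A l' j (e j)) n) = \<ominus> A m l (A l' k (e k)) n"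
      if "m \<in> insert k I" "l \<in> insert k I" "l' \<in> insert k I" for m l l'
    proof -
      have "(\<Oplus>j\<in>I. A m l (A l' j (e j)) n) = A m l (\<lambda>n. \<Oplus>j\<in>I. A l' j (e j) n) n"
        using that cl finI by (intro shift_poly_finsum[OF op, symmetric]) auto
      also have "\<dots> = A m l (\<lambda>n. \<ominus> A l' k (e k) n) n" using solve that by simp
      also have "\<dots> = \<ominus> A m l (A l' k (e k)) n"
        using that cl by (intro shift_poly_uminus_arg[OF op]) auto
      finally show ?thesis .
    qed
    have cl2: "A m l (A l' j (e j)) n \<in> carrier R"
      if "m \<in> insert k I" "l \<in> insert k I" "l' \<in> insert k I" "j \<in> insert k I" for m l l' j
      using seqs_closed[OF shift_poly_closed[OF op[OF that(1,2)] cl[OF that(3,4,4)]]] .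
    have "(\<Oplus>j\<in>I. B i j (e j) n) =
        (\<Oplus>j\<in>I. A k k (A i j (e j)) n \<oplus> \<ominus> \<one> \<otimes> A i k (A k j (e j)) n)"
      unfolding B_def using cl2 i
      by (intro finsum_cong') (auto simp: Pi_iff a_minus_def l_minus)
    also have "\<dots> = (\<Oplus>j\<in>I. A k k (A i j (e j)) n) \<oplus> \<ominus> \<one> \<otimes> (\<Oplus>j\<in>I. A i k (A k j (e j)) n)"
      using cl2 i finI by (subst finsum_addf) (auto simp: Pi_iff finsum_rdistr)
    \<comment> \<open>Both sums collapse to products of \<open>A k k\<close> and
      \<open>A i k\<close> applied to \<open>e k\<close>, in opposite order and with opposite signs.
      They cancel because polynomials in \<open>E\<close> commute.\<close>
    also have "\<dots> = \<ominus> A k k (A i k (e k)) n \<oplus> A i k (A k k (e k)) n"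
      using part[of k k i] part[of i k k] cl2 i by (simp add: l_minus)
    also have "\<dots> = \<zero>"
      using shift_poly_comm[OF op op e, of k k i k k n] cl2 i by (simp add: l_neg)
    finally show "(\<Oplus>j\<in>insert i0 F. B i j (e j) n) = \<zero>" by (simp add: I_def)
  next
    fix i j assume "i \<in> insert i0 F" "j \<in> insert i0 F" "i \<noteq> j"
    then have i: "i \<in> I" and j: "j \<in> I" by (simp_all add: I_def)
    \<comment> \<open>The bounds \<open>Suc d\<close> on the diagonal and \<open>d\<close> off it
      combine to exactly \<open>Suc d + d - 1 = d + d\<close>.\<close>
    have "shift_poly (d + d) (\<lambda>a. A k k (A i j a))"
      using shift_poly_comp[OF op[of k k] low[of i j]] i j \<open>i \<noteq> j\<close> by simp
    then show "shift_poly (d + d) (B i j)" unfolding B_def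
      using i j by (intro shift_poly_minus corr) auto
  qed
qed

section \<open>Linear recurrent sequences and shift-stable modules\<close>

text \<open>The right-hand side says that the monic polynomial \<open>E^d - S\<close> kills
  \<open>a\<close>. A recurrence looks back from \<open>n\<close> and a shift polynomial looks
  forward; the reflection of \<open>i\<close> to \<open>N - i\<close> translates between
  them.\<close>

lemma lin_rec_seqs_iff_shift_poly:
  "a \<in> lin_rec_seqs R \<longleftrightarrow>
     a \<in> seqs \<and> (\<exists>d S. shift_poly d S \<and> (\<forall>n. a (n + d) = S a n))"
proof
  assume "a \<in> lin_rec_seqs R"
  then obtain N h where a: "a \<in> seqs" and h: "\<And>i. i \<in> {1..N} \<Longrightarrow> h i \<in> carrier R"
    and rec: "\<And>n. n \<ge> N \<Longrightarrow> a n = (\<Oplus>i\<in>{1..N}. h i \<otimes> a (n - i))"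
    unfolding lin_rec_seqs_def seqs_def by blast
  \<comment> \<open>\<open>h\<close> is known to lie in the carrier only on \<open>{1..N}\<close>,
    whereas \<open>seqs\<close> asks for every index; hence the default
    \<open>\<zero>\<close>.\<close>
  define c where "c i = (if i < N then h (N - i) else \<zero>)" for i
  have c: "c \<in> seqs" using h by (auto simp: c_def)
  have img: "{1..N} = (\<lambda>i. N - i) ` {..<N}"
    by (rule bij_betw_imp_surj_on[symmetric], rule bij_betw_byWitness[where f' = "\<lambda>i. N - i"]) auto
  have "a (n + N) = (\<Oplus>i\<in>{..<N}. c i \<otimes> a (n + i))" for n
  proof -
    have "a (n + N) = (\<Oplus>i\<in>(\<lambda>i. N - i) ` {..<N}. h i \<otimes> a (n + N - i))"
      using rec[of "n + N"] img by simp
    also have "\<dots> = (\<Oplus>i\<in>{..<N}. h (N - i) \<otimes> a (n + N - (N - i)))"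
      by (rule finsum_reindex) (use h a in \<open>auto simp: inj_on_def\<close>)
    also have "\<dots> = (\<Oplus>i\<in>{..<N}. c i \<otimes> a (n + i))"
      by (intro finsum_cong') (use h a in \<open>auto simp: c_def\<close>)
    finally show ?thesis .
  qed
  moreover have "shift_poly N (\<lambda>a n. \<Oplus>i\<in>{..<N}. c i \<otimes> a (n + i))"
    using c unfolding shift_poly_def by blast
  ultimately show "a \<in> seqs \<and> (\<exists>d S. shift_poly d S \<and> (\<forall>n. a (n + d) = S a n))"
    using a by blast
next
  assume "a \<in> seqs \<and> (\<exists>d S. shift_poly d S \<and> (\<forall>n. a (n + d) = S a n))"
  then obtain d c where a: "a \<in> seqs" and c: "c \<in> seqs"
    and rec: "\<And>n. a (n + d) = (\<Oplus>i\<in>{..<d}. c i \<otimes> a (n + i))"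
    unfolding shift_poly_def by metis
  have img: "{..<d} = (\<lambda>i. d - i) ` {1..d}"
    by (rule bij_betw_imp_surj_on[symmetric], rule bij_betw_byWitness[where f' = "\<lambda>i. d - i"]) auto
  have "a n = (\<Oplus>i\<in>{1..d}. c (d - i) \<otimes> a (n - i))" if "n \<ge> d" for n
  proof -
    have "a n = (\<Oplus>i\<in>(\<lambda>i. d - i) ` {1..d}. c i \<otimes> a (n - d + i))"
      using rec[of "n - d"] that img by simp
    also have "\<dots> = (\<Oplus>i\<in>{1..d}. c (d - i) \<otimes> a (n - d + (d - i)))"
      by (rule finsum_reindex) (use c a in \<open>auto simp: inj_on_def\<close>)
    also have "\<dots> = (\<Oplus>i\<in>{1..d}. c (d - i) \<otimes> a (n - i))"
      by (intro finsum_cong') (use c a that in auto)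
    finally show ?thesis .
  qed
  then show "a \<in> lin_rec_seqs R"
    unfolding lin_rec_seqs_def using a c
    by (auto intro!: exI[of _ d] exI[of _ "\<lambda>i. c (d - i)"])
qed

lemma lin_rec_seqs_imp_seqs: "a \<in> lin_rec_seqs R \<Longrightarrow> a \<in> seqs"
  by (simp add: lin_rec_seqs_iff_shift_poly)

section \<open>Finitely generated modules of sequences\<close>

text \<open>The generated submodule is given inductively, so that claims about linear maps follow by
  rule induction. Explicit coefficients are recovered for finite \<open>G\<close> in
  \<open>seq_span_finite_combination\<close>.\<close>

inductive_set seq_span :: "(nat \<Rightarrow> 'a) set \<Rightarrow> (nat \<Rightarrow> 'a) set"
  for G :: "(nat \<Rightarrow> 'a) set" where
  seq_span_zero: "(\<lambda>n. \<zero>) \<in> seq_span G"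
| seq_span_base: "g \<in> G \<Longrightarrow> g \<in> seq_span G"
| seq_span_add: "a \<in> seq_span G \<Longrightarrow> b \<in> seq_span G \<Longrightarrow> (\<lambda>n. a n \<oplus> b n) \<in> seq_span G"
| seq_span_smult: "r \<in> carrier R \<Longrightarrow> a \<in> seq_span G \<Longrightarrow> (\<lambda>n. r \<otimes> a n) \<in> seq_span G"

lemma seq_span_subset_seqs:
  assumes "G \<subseteq> seqs" "a \<in> seq_span G"
  shows "a \<in> seqs"
  using assms(2) by induction (use assms(1) in auto)

lemma seq_span_mono:
  assumes "a \<in> seq_span G" "G \<subseteq> H"
  shows "a \<in> seq_span H"
  using assms(1) by induction (use assms(2) in \<open>auto intro: seq_span.intros\<close>)

lemma seq_span_finsum:
  assumes "finite J" "G \<subseteq> seqs" "\<And>j. j \<in> J \<Longrightarrow> f j \<in> seq_span G"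
  shows "(\<lambda>n. \<Oplus>j\<in>J. f j n) \<in> seq_span G"
  using assms(1,3)
proof (induction J rule: finite_induct)
  case empty
  then show ?case by (simp add: seq_span_zero)
next
  case (insert j J)
  have "(\<lambda>n. \<Oplus>j\<in>insert j J. f j n) = (\<lambda>n. f j n \<oplus> (\<Oplus>j\<in>J. f j n))"
    using insert seqs_closed[OF seq_span_subset_seqs[OF assms(2)]]
    by (intro ext finsum_insert) auto
  with insert show ?case by (simp add: seq_span_add)
qed

text \<open>Reduces claims about a linear map to generators. It serves the shift, the Hadamard
  product in each argument and the twist.\<close>

lemma seq_span_image:
  assumes "x \<in> seq_span G" "G \<subseteq> seqs"
    and zero: "f (\<lambda>n. \<zero>) = (\<lambda>n. \<zero>)"
    and add: "\<And>a b. a \<in> seqs \<Longrightarrow> b \<in> seqs \<Longrightarrow> f (\<lambda>n. a n \<oplus> b n) = (\<lambda>n. f a n \<oplus> f b n)"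
    and smult: "\<And>r a. r \<in> carrier R \<Longrightarrow> a \<in> seqs \<Longrightarrow> f (\<lambda>n. r \<otimes> a n) = (\<lambda>n. r \<otimes> f a n)"
    and base: "\<And>g. g \<in> G \<Longrightarrow> f g \<in> seq_span H"
  shows "f x \<in> seq_span H"
  using assms(1)
  by induction
    (use seq_span_subset_seqs[OF assms(2)] in \<open>auto simp: zero add smult intro: base seq_span.intros\<close>)

lemma seq_span_shift:
  assumes "x \<in> seq_span G" "G \<subseteq> seqs" "\<And>g. g \<in> G \<Longrightarrow> (\<lambda>n. g (Suc n)) \<in> seq_span G"
  shows "(\<lambda>n. x (Suc n)) \<in> seq_span G"
  by (rule seq_span_image[OF assms(1), where f = "\<lambda>x n. x (Suc n)"]) (use assms in auto)

lemma seq_span_finite_combination: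
  assumes "x \<in> seq_span G" "finite G" "G \<subseteq> seqs"
  shows "\<exists>c\<in>UNIV \<rightarrow> carrier R. \<forall>n. x n = (\<Oplus>g\<in>G. c g \<otimes> g n)"
  using assms(1)
proof induction
  case seq_span_zero
  have "(\<Oplus>g\<in>G. \<zero> \<otimes> g n) = (\<Oplus>g\<in>G. \<zero>)" for n
    using assms(3) by (intro finsum_cong') (auto simp: subset_iff)
  then show ?case by (intro bexI[of _ "\<lambda>g. \<zero>"]) auto
next
  case (seq_span_base g)
  have "(\<Oplus>h\<in>G. (if h = g then \<one> else \<zero>) \<otimes> h n) = g n" for n
  proof -
    have "(\<Oplus>h\<in>G. (if h = g then \<one> else \<zero>) \<otimes> h n) = (\<Oplus>h\<in>G. if h = g then h n else \<zero>)"
      using assms(3) by (intro finsum_cong') (auto simp: subset_iff)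
    also have "\<dots> = g n"
      using assms seq_span_base by (intro add.finprod_singleton_swap) (auto simp: subset_iff)
    finally show ?thesis .
  qed
  then show ?case by (intro bexI[of _ "\<lambda>h. if h = g then \<one> else \<zero>"]) auto
next
  case (seq_span_add a b)
  then obtain c d where c: "c \<in> UNIV \<rightarrow> carrier R" "\<And>n. a n = (\<Oplus>g\<in>G. c g \<otimes> g n)"
    and d: "d \<in> UNIV \<rightarrow> carrier R" "\<And>n. b n = (\<Oplus>g\<in>G. d g \<otimes> g n)" by blast
  have "a n \<oplus> b n = (\<Oplus>g\<in>G. (c g \<oplus> d g) \<otimes> g n)" for n
  proof -
    have "a n \<oplus> b n = (\<Oplus>g\<in>G. c g \<otimes> g n \<oplus> d g \<otimes> g n)"
      unfolding c(2) d(2) using c(1) d(1) assms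
      by (intro finsum_addf[symmetric]) (auto simp: Pi_iff subset_iff)
    also have "\<dots> = (\<Oplus>g\<in>G. (c g \<oplus> d g) \<otimes> g n)"
      using c(1) d(1) assms by (intro finsum_cong') (auto simp: Pi_iff subset_iff l_distr)
    finally show ?thesis .
  qed
  then show ?case using c(1) d(1) by (intro bexI[of _ "\<lambda>g. c g \<oplus> d g"]) auto
next
  case (seq_span_smult r a)
  then obtain c where c: "c \<in> UNIV \<rightarrow> carrier R" "\<And>n. a n = (\<Oplus>g\<in>G. c g \<otimes> g n)"
    by blast
  have "r \<otimes> a n = (\<Oplus>g\<in>G. (r \<otimes> c g) \<otimes> g n)" for n
  proof -
    have "r \<otimes> a n = (\<Oplus>g\<in>G. r \<otimes> (c g \<otimes> g n))"
      unfolding c(2) using c(1) assms seq_span_smult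
      by (intro finsum_rdistr) (auto simp: Pi_iff subset_iff)
    also have "\<dots> = (\<Oplus>g\<in>G. (r \<otimes> c g) \<otimes> g n)"
      using c(1) assms seq_span_smult
      by (intro finsum_cong') (auto simp: Pi_iff subset_iff m_assoc)
    finally show ?thesis .
  qed
  then show ?case using c(1) seq_span_smult(1) by (intro bexI[of _ "\<lambda>g. r \<otimes> c g"]) auto
qed

text \<open>Expressing the shifts of the generators by the generators gives a matrix
  \<open>c\<close>, and the vector of generators is annihilated by \<open>E I - c\<close>. The
  diagonal is monic of degree 1 and the other entries are constants, so elimination yields a monic
  polynomial killing \<open>x\<close>.\<close>

lemma shift_stable_span_imp_lin_rec:
  assumes "finite G" "G \<subseteq> seqs" "\<And>g. g \<in> G \<Longrightarrow> (\<lambda>n. g (Suc n)) \<in> seq_span G"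
    and x: "x \<in> seq_span G"
  shows "x \<in> lin_rec_seqs R"
proof -
  \<comment> \<open>Adjoining \<open>x\<close> makes it one of the unknowns; by
    \<open>seq_span_shift\<close> its shift still lies in the span.\<close>
  define H where "H = insert x G"
  have H: "finite H" "H \<subseteq> seqs" and Hx: "insert x (H - {x}) = H"
    using assms seq_span_subset_seqs[OF assms(2)] by (auto simp: H_def)
  have "\<exists>c\<in>UNIV \<rightarrow> carrier R. \<forall>n. g (Suc n) = (\<Oplus>h\<in>H. c h \<otimes> h n)" if "g \<in> H" for g
  proof -
    have "(\<lambda>n. g (Suc n)) \<in> seq_span G"
      using that assms(3) seq_span_shift[OF x assms(2,3)] by (auto simp: H_def)
    then have "(\<lambda>n. g (Suc n)) \<in> seq_span H"
      by (rule seq_span_mono) (auto simp: H_def)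
    from seq_span_finite_combination[OF this H] show ?thesis .
  qed
  then have "\<forall>g\<in>H. \<exists>c. c \<in> UNIV \<rightarrow> carrier R \<and> (\<forall>n. g (Suc n) = (\<Oplus>h\<in>H. c h \<otimes> h n))"
    by blast
  from bchoice[OF this] obtain c where
    "\<forall>g\<in>H. c g \<in> UNIV \<rightarrow> carrier R \<and> (\<forall>n. g (Suc n) = (\<Oplus>h\<in>H. c g h \<otimes> h n))" ..
  then have c: "\<And>g h. g \<in> H \<Longrightarrow> c g h \<in> carrier R"
    and shift: "\<And>g n. g \<in> H \<Longrightarrow> g (Suc n) = (\<Oplus>h\<in>H. c g h \<otimes> h n)"
    by (simp_all add: Pi_iff)
  \<comment> \<open>This is the matrix \<open>E I - c\<close>. The generators index its rows and
    columns and are themselves the unknowns, so below \<open>e\<close> is the identity.\<close>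
  define A where "A g h a n = (if h = g then a (Suc n) else \<zero>) \<oplus> \<ominus> c g h \<otimes> a n"
    for g h a n
  have const: "shift_poly 1 (\<lambda>a n. r \<otimes> a n)" if "r \<in> carrier R" for r
    unfolding shift_poly_def
    using that by (intro bexI[of _ "\<lambda>_. r"]) (auto simp: lessThan_Suc)
  have "\<exists>d T. monic_shift_poly d T \<and> (\<forall>n. T x n = \<zero>)"
  proof (rule shift_poly_elimination[where F = "H - {x}" and e = "\<lambda>g. g" and A = A and d = 1],
      unfold Hx)
    show "finite (H - {x})" using H by simp
    show "x \<notin> H - {x}" by simp
    show "g \<in> seqs" if "g \<in> H" for g using that H by auto
    show "monic_shift_poly 1 (A g g)" if "g \<in> H" for g
      unfolding monic_shift_poly_def A_def
      using const c[OF that] by (intro exI[of _ "\<lambda>a n. \<ominus> c g g \<otimes> a n"]) auto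
    show "shift_poly 1 (A g h)" if "g \<in> H" "h \<in> H" "g \<noteq> h" for g h
      using const[of "\<ominus> c g h"] c that by (auto intro: shift_poly_cong simp: A_def)
    show "(\<Oplus>h\<in>H. A g h h n) = \<zero>" if g: "g \<in> H" for g n
    proof -
      have "(\<Oplus>h\<in>H. A g h h n) =
          (\<Oplus>h\<in>H. if h = g then h (Suc n) else \<zero>) \<oplus> (\<Oplus>h\<in>H. \<ominus> c g h \<otimes> h n)"
        unfolding A_def using c[OF g] H by (intro finsum_addf) (auto simp: subset_iff)
      also have "(\<Oplus>h\<in>H. if h = g then h (Suc n) else \<zero>) = g (Suc n)"
        using H g by (intro add.finprod_singleton_swap) (auto simp: subset_iff)
      also have "(\<Oplus>h\<in>H. \<ominus> c g h \<otimes> h n) = (\<Oplus>h\<in>H. \<ominus> \<one> \<otimes> (c g h \<otimes> h n))"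
        using c[OF g] H by (intro finsum_cong') (auto simp: subset_iff l_minus)
      also have "\<dots> = \<ominus> \<one> \<otimes> g (Suc n)"
        unfolding shift[OF g] using c[OF g] H
        by (intro finsum_rdistr[symmetric]) (auto simp: subset_iff)
      also have "g (Suc n) \<oplus> \<ominus> \<one> \<otimes> g (Suc n) = \<zero>"
        using H g by (auto simp: l_minus r_neg subset_iff)
      finally show ?thesis .
    qed
  qed
  then obtain d T where T: "monic_shift_poly d T" "\<And>n. T x n = \<zero>" by blast
  have xs: "x \<in> seqs" using H by (simp add: H_def)
  obtain S where S: "shift_poly d S" "\<And>n. T x n = x (n + d) \<oplus> S x n"
    using T(1) xs unfolding monic_shift_poly_def by blast
  have "x (n + d) = \<ominus> S x n" for n
    using S(2)[of n] T(2) xs seqs_closed[OF shift_poly_closed[OF S(1) xs]]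
    by (intro sum_zero_eq_neg) auto
  with shift_poly_uminus[OF S(1)] xs show ?thesis
    unfolding lin_rec_seqs_iff_shift_poly by blast
qed

lemma lin_rec_seqs_iff_span:
  "a \<in> lin_rec_seqs R \<longleftrightarrow>
     (\<exists>G. finite G \<and> G \<subseteq> seqs \<and> (\<forall>g\<in>G. (\<lambda>n. g (Suc n)) \<in> seq_span G) \<and> a \<in> seq_span G)"
proof
  assume "a \<in> lin_rec_seqs R"
  then obtain N c where a: "a \<in> seqs" and c: "c \<in> seqs"
    and rec: "\<And>n. a (n + N) = (\<Oplus>i\<in>{..<N}. c i \<otimes> a (n + i))"
    unfolding lin_rec_seqs_iff_shift_poly shift_poly_def by metis
  \<comment> \<open>The window of \<open>a\<close> and its first \<open>N\<close> shifts. Including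
    index \<open>N\<close> keeps \<open>a\<close> in \<open>G\<close> even when
    \<open>N = 0\<close>.\<close>
  define G where "G = (\<lambda>i n. a (n + i)) ` {..N}"
  have G: "finite G" "G \<subseteq> seqs" using a by (auto simp: G_def)
  have base: "(\<lambda>n. a (n + i)) \<in> seq_span G" if "i \<le> N" for i
    using that by (intro seq_span_base) (auto simp: G_def)
  have "(\<lambda>n. a (Suc n + i)) \<in> seq_span G" if "i \<le> N" for i
  proof (cases "i = N")
    case True
    \<comment> \<open>Only the last shift leaves the window; the recurrence at \<open>Suc n\<close>
      brings it back.\<close>
    have "(\<lambda>n. \<Oplus>j\<in>{..<N}. c j \<otimes> a (n + Suc j)) \<in> seq_span G"
      using G c by (intro seq_span_finsum seq_span_smult base) auto
    then show ?thesis using rec[of "Suc _"] True by simp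
  next
    case False
    then show ?thesis using base[of "Suc i"] that by simp
  qed
  then have "\<forall>g\<in>G. (\<lambda>n. g (Suc n)) \<in> seq_span G" by (auto simp: G_def)
  moreover have "a \<in> seq_span G" using base[of 0] by simp
  ultimately show "\<exists>G. finite G \<and> G \<subseteq> seqs \<and> (\<forall>g\<in>G. (\<lambda>n. g (Suc n)) \<in> seq_span G) \<and>
      a \<in> seq_span G"
    using G by blast
qed (auto intro: shift_stable_span_imp_lin_rec)

section \<open>Closure of linear recurrent sequences\<close>

lemma lin_rec_seqs_zero: "(\<lambda>n. \<zero>) \<in> lin_rec_seqs R"
  unfolding lin_rec_seqs_iff_span by (intro exI[of _ "{}"]) (auto intro: seq_span_zero)

lemma lin_rec_seqs_one: "(\<lambda>n. \<one>) \<in> lin_rec_seqs R"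
  unfolding lin_rec_seqs_iff_span
  by (intro exI[of _ "{\<lambda>n. \<one>}"]) (auto intro: seq_span_base)

lemma lin_rec_seqs_smult:
  "r \<in> carrier R \<Longrightarrow> a \<in> lin_rec_seqs R \<Longrightarrow> (\<lambda>n. r \<otimes> a n) \<in> lin_rec_seqs R"
  unfolding lin_rec_seqs_iff_span by (auto intro: seq_span_smult)

lemma lin_rec_seqs_add:
  assumes "a \<in> lin_rec_seqs R" "b \<in> lin_rec_seqs R"
  shows "(\<lambda>n. a n \<oplus> b n) \<in> lin_rec_seqs R"
proof -
  obtain G where G: "finite G" "G \<subseteq> seqs" "\<And>g. g \<in> G \<Longrightarrow> (\<lambda>n. g (Suc n)) \<in> seq_span G"
    "a \<in> seq_span G"
    using assms(1) unfolding lin_rec_seqs_iff_span by blast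
  obtain H where H: "finite H" "H \<subseteq> seqs" "\<And>h. h \<in> H \<Longrightarrow> (\<lambda>n. h (Suc n)) \<in> seq_span H"
    "b \<in> seq_span H"
    using assms(2) unfolding lin_rec_seqs_iff_span by blast
  have "x \<in> seq_span (G \<union> H)" if "x \<in> seq_span G \<or> x \<in> seq_span H" for x
    using that seq_span_mono[of x G "G \<union> H"] seq_span_mono[of x H "G \<union> H"] by auto
  with G H show ?thesis
    unfolding lin_rec_seqs_iff_span
    by (intro exI[of _ "G \<union> H"]) (auto intro: seq_span_add)
qed

text \<open>The products of generators span a shift-stable module: \<open>E\<close> is
  multiplicative for the componentwise product, and by bilinearity products of span elements lie in
  the span of \<open>K\<close>.\<close>

lemma lin_rec_seqs_hadamard:
  assumes "a \<in> lin_rec_seqs R" "b \<in> lin_rec_seqs R"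
  shows "(\<lambda>n. a n \<otimes> b n) \<in> lin_rec_seqs R"
proof -
  obtain G where G: "finite G" "G \<subseteq> seqs" "\<And>g. g \<in> G \<Longrightarrow> (\<lambda>n. g (Suc n)) \<in> seq_span G"
    "a \<in> seq_span G"
    using assms(1) unfolding lin_rec_seqs_iff_span by blast
  obtain H where H: "finite H" "H \<subseteq> seqs" "\<And>h. h \<in> H \<Longrightarrow> (\<lambda>n. h (Suc n)) \<in> seq_span H"
    "b \<in> seq_span H"
    using assms(2) unfolding lin_rec_seqs_iff_span by blast
  define K where "K = (\<lambda>(g, h) n. g n \<otimes> h n) ` (G \<times> H)"
  have K: "finite K" "K \<subseteq> seqs" using G(1,2) H(1,2) by (auto simp: K_def subset_iff)
  have prod: "(\<lambda>n. x n \<otimes> y n) \<in> seq_span K" if x: "x \<in> seq_span G" and y: "y \<in> seq_span H" for x y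
  proof (rule seq_span_image[OF x G(2), where f = "\<lambda>x n. x n \<otimes> y n"])
    have ys: "y \<in> seqs" using y H(2) by (rule seq_span_subset_seqs[rotated])
    then show "(\<lambda>n. \<zero> \<otimes> y n) = (\<lambda>n. \<zero>)" by auto
    show "(\<lambda>n. (a n \<oplus> b n) \<otimes> y n) = (\<lambda>n. a n \<otimes> y n \<oplus> b n \<otimes> y n)"
      if "a \<in> seqs" "b \<in> seqs" for a b using that ys by (auto simp: l_distr)
    show "(\<lambda>n. r \<otimes> a n \<otimes> y n) = (\<lambda>n. r \<otimes> (a n \<otimes> y n))"
      if "r \<in> carrier R" "a \<in> seqs" for r a using that ys by (auto simp: m_assoc)
    show "(\<lambda>n. g n \<otimes> y n) \<in> seq_span K" if g: "g \<in> G" for g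
    proof (rule seq_span_image[OF y H(2), where f = "\<lambda>y n. g n \<otimes> y n"])
      have gs: "g \<in> seqs" using g G(2) by auto
      then show "(\<lambda>n. g n \<otimes> \<zero>) = (\<lambda>n. \<zero>)" by auto
      show "(\<lambda>n. g n \<otimes> (a n \<oplus> b n)) = (\<lambda>n. g n \<otimes> a n \<oplus> g n \<otimes> b n)"
        if "a \<in> seqs" "b \<in> seqs" for a b using that gs by (auto simp: r_distr)
      show "(\<lambda>n. g n \<otimes> (r \<otimes> a n)) = (\<lambda>n. r \<otimes> (g n \<otimes> a n))"
        if "r \<in> carrier R" "a \<in> seqs" for r a using that gs by (auto simp: m_lcomm)
      show "(\<lambda>n. g n \<otimes> h n) \<in> seq_span K" if "h \<in> H" for h
        using g that by (intro seq_span_base) (auto simp: K_def)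
    qed
  qed
  have "(\<lambda>n. k (Suc n)) \<in> seq_span K" if "k \<in> K" for k
    using that G(3) H(3) prod by (auto simp: K_def)
  with K prod[OF G(4) H(4)] show ?thesis
    unfolding lin_rec_seqs_iff_span by blast
qed

section \<open>Binomial sums and the Newton product\<close>

text \<open>This is \<open>(1 + E)^n x\<close> evaluated at index 0. Both the Hurwitz and the Newton
  product have this form, so Pascal's rule is proved once.\<close>

definition binom_sum :: "nat \<Rightarrow> (nat \<Rightarrow> 'a) \<Rightarrow> 'a" where
  "binom_sum n x = (\<Oplus>i\<in>{0..n}. [(n choose i)] \<cdot>\<^bsub>R\<^esub> x i)"

lemma binom_sum_closed [simp]: "x \<in> seqs \<Longrightarrow> binom_sum n x \<in> carrier R"
  by (auto simp: binom_sum_def intro!: finsum_closed)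

lemma binom_sum_cong:
  "y \<in> seqs \<Longrightarrow> (\<And>i. i \<le> n \<Longrightarrow> x i = y i) \<Longrightarrow> binom_sum n x = binom_sum n y"
  unfolding binom_sum_def by (intro finsum_cong') auto

text \<open>Pascal's rule, in the form
  \<open>(1 + E)^(n + 1) = (1 + E)^n + (1 + E)^n E\<close>.\<close>

lemma binom_sum_Suc:
  assumes x: "x \<in> seqs"
  shows "binom_sum (Suc n) x = binom_sum n x \<oplus> binom_sum n (\<lambda>i. x (Suc i))"
proof -
  have sum: "binom_sum n x = (\<Oplus>i\<in>{..<Suc n}. [(n choose i)] \<cdot>\<^bsub>R\<^esub> x i)" for n x
    by (simp add: binom_sum_def lessThan_Suc_atMost atLeast0AtMost)
  let ?s = "\<Oplus>i\<in>{..<Suc n}. [(n choose Suc i)] \<cdot>\<^bsub>R\<^esub> x (Suc i)"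
  have s: "?s \<in> carrier R" using x by (intro finsum_closed) auto
  have "binom_sum (Suc n) x =
      [(Suc n choose 0)] \<cdot>\<^bsub>R\<^esub> x 0 \<oplus> (\<Oplus>i\<in>{..<Suc n}. [(Suc n choose Suc i)] \<cdot>\<^bsub>R\<^esub> x (Suc i))"
    unfolding sum using x by (intro finsum_lessThan_Suc2) auto
  also have "(\<Oplus>i\<in>{..<Suc n}. [(Suc n choose Suc i)] \<cdot>\<^bsub>R\<^esub> x (Suc i)) =
      (\<Oplus>i\<in>{..<Suc n}. [(n choose i)] \<cdot>\<^bsub>R\<^esub> x (Suc i) \<oplus> [(n choose Suc i)] \<cdot>\<^bsub>R\<^esub> x (Suc i))"
    using x by (intro finsum_cong') (auto simp: add.nat_pow_mult)
  also have "\<dots> = binom_sum n (\<lambda>i. x (Suc i)) \<oplus> ?s"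
    unfolding sum using x by (intro finsum_addf) auto
  finally have 1: "binom_sum (Suc n) x = x 0 \<oplus> (binom_sum n (\<lambda>i. x (Suc i)) \<oplus> ?s)"
    using x by simp
  \<comment> \<open>The sum with the extra index \<open>Suc n\<close>, whose coefficient
    \<open>n choose Suc n\<close> is 0, is split at both ends; comparison gives
    \<open>binom_sum n x = x 0 \<oplus> ?s\<close>.\<close>
  have "(\<Oplus>i\<in>{..<Suc (Suc n)}. [(n choose i)] \<cdot>\<^bsub>R\<^esub> x i) = [(n choose 0)] \<cdot>\<^bsub>R\<^esub> x 0 \<oplus> ?s"
    using x by (intro finsum_lessThan_Suc2) auto
  moreover have "(\<Oplus>i\<in>{..<Suc (Suc n)}. [(n choose i)] \<cdot>\<^bsub>R\<^esub> x i) =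
      [(n choose Suc n)] \<cdot>\<^bsub>R\<^esub> x (Suc n) \<oplus> binom_sum n x"
    unfolding sum using x by (intro finsum_lessThan_Suc) auto
  ultimately have "binom_sum n x = x 0 \<oplus> ?s" using x by (simp add: binomial_eq_0)
  moreover have "(\<lambda>i. x (Suc i)) \<in> seqs" using x by auto
  ultimately show ?thesis using 1 x s by (simp add: a_ac)
qed

lemma binom_sum_add:
  "x \<in> seqs \<Longrightarrow> y \<in> seqs \<Longrightarrow> binom_sum n (\<lambda>i. x i \<oplus> y i) = binom_sum n x \<oplus> binom_sum n y"
  by (simp add: binom_sum_def add.nat_pow_distrib finsum_addf)

lemma binom_sum_smult:
  assumes "r \<in> carrier R" "x \<in> seqs"
  shows "binom_sum n (\<lambda>i. r \<otimes> x i) = r \<otimes> binom_sum n x"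
  using assms by (simp add: binom_sum_def add_pow_rdistr[symmetric] finsum_rdistr)

lemma hurwitz_eq_binom_sum: "hurwitz R a b n = binom_sum n (\<lambda>i. a i \<otimes> b (n - i))"
  by (simp add: hurwitz_def binom_sum_def)

lemma hurwitz_Suc:
  assumes "a \<in> seqs" "b \<in> seqs"
  shows "hurwitz R a b (Suc n) =
    hurwitz R (\<lambda>n. a (Suc n)) b n \<oplus> hurwitz R a (\<lambda>n. b (Suc n)) n"
proof -
  have "binom_sum (Suc n) (\<lambda>i. a i \<otimes> b (Suc n - i)) =
      binom_sum n (\<lambda>i. a i \<otimes> b (Suc n - i)) \<oplus> binom_sum n (\<lambda>i. a (Suc i) \<otimes> b (n - i))"
    using assms by (subst binom_sum_Suc) auto
  also have "binom_sum n (\<lambda>i. a i \<otimes> b (Suc n - i)) = binom_sum n (\<lambda>i. a i \<otimes> b (Suc (n - i)))"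
    using assms by (intro binom_sum_cong) (auto simp: Suc_diff_le)
  finally show ?thesis
    unfolding hurwitz_eq_binom_sum using assms
    by (subst a_comm) (auto intro!: binom_sum_closed)
qed

text \<open>The factors \<open>n choose i\<close> and \<open>a i\<close> do not depend on
  \<open>j\<close> and leave the inner sum. The nested form lets Pascal's rule act on each level
  separately.\<close>

lemma newton_eq_binom_sum:
  assumes "a \<in> seqs" "b \<in> seqs"
  shows "newton R a b n = binom_sum n (\<lambda>i. a i \<otimes> binom_sum i (\<lambda>j. b (n - j)))"
  unfolding newton_def binom_sum_def[of n]
proof (intro finsum_cong')
  fix i
  have sum: "(\<Oplus>j\<in>{0..i}. [(i choose j)] \<cdot>\<^bsub>R\<^esub> b (n - j)) \<in> carrier R"
    using assms by (intro finsum_closed) auto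
  have "(\<Oplus>j\<in>{0..i}. [((n choose i) * (i choose j))] \<cdot>\<^bsub>R\<^esub> (a i \<otimes> b (n - j))) =
      (\<Oplus>j\<in>{0..i}. [(n choose i)] \<cdot>\<^bsub>R\<^esub> a i \<otimes> [(i choose j)] \<cdot>\<^bsub>R\<^esub> b (n - j))"
    using assms by (intro finsum_cong')
      (auto simp: add_pow_ldistr add_pow_rdistr add.nat_pow_pow mult.commute)
  also have "\<dots> = [(n choose i)] \<cdot>\<^bsub>R\<^esub> a i \<otimes> binom_sum i (\<lambda>j. b (n - j))"
    unfolding binom_sum_def using assms by (intro finsum_rdistr[symmetric]) auto
  also have "\<dots> = [(n choose i)] \<cdot>\<^bsub>R\<^esub> (a i \<otimes> binom_sum i (\<lambda>j. b (n - j)))"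
    using assms by (intro add_pow_ldistr binom_sum_closed) auto
  finally show "(\<Oplus>j\<in>{0..i}. [((n choose i) * (i choose j))] \<cdot>\<^bsub>R\<^esub> (a i \<otimes> b (n - j))) =
      [(n choose i)] \<cdot>\<^bsub>R\<^esub> (a i \<otimes> binom_sum i (\<lambda>j. b (n - j)))" .
qed (use assms in \<open>auto intro!: add.nat_pow_closed m_closed binom_sum_closed\<close>)

text \<open>Pascal's rule splits the outer sum in two. In the part with \<open>a (Suc i)\<close> the
  inner sum runs up to \<open>Suc i\<close> and splits again, hence three summands.\<close>

lemma newton_Suc:
  assumes "a \<in> seqs" "b \<in> seqs"
  shows "newton R a b (Suc n) = newton R a (\<lambda>n. b (Suc n)) n \<oplus>
    (newton R (\<lambda>n. a (Suc n)) (\<lambda>n. b (Suc n)) n \<oplus> newton R (\<lambda>n. a (Suc n)) b n)"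
proof -
  have a': "(\<lambda>n. a (Suc n)) \<in> seqs" and b': "(\<lambda>n. b (Suc n)) \<in> seqs" using assms by auto
  have bd: "(\<lambda>j. b (m - j)) \<in> seqs" "(\<lambda>j. b (Suc (m - j))) \<in> seqs" for m using assms by auto
  have inner: "binom_sum i (\<lambda>j. b (Suc n - j)) = binom_sum i (\<lambda>j. b (Suc (n - j)))" if "i \<le> n" for i
    using assms that by (intro binom_sum_cong) (auto simp: Suc_diff_le)
  have "newton R a b (Suc n) =
      binom_sum n (\<lambda>i. a i \<otimes> binom_sum i (\<lambda>j. b (Suc n - j))) \<oplus>
      binom_sum n (\<lambda>i. a (Suc i) \<otimes> binom_sum (Suc i) (\<lambda>j. b (Suc n - j)))"
    unfolding newton_eq_binom_sum[OF assms] using assms bd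
    by (intro binom_sum_Suc) auto
  also have "binom_sum n (\<lambda>i. a i \<otimes> binom_sum i (\<lambda>j. b (Suc n - j))) =
      newton R a (\<lambda>n. b (Suc n)) n"
    unfolding newton_eq_binom_sum[OF assms(1) b'] using assms bd inner
    by (intro binom_sum_cong) auto
  also have "binom_sum n (\<lambda>i. a (Suc i) \<otimes> binom_sum (Suc i) (\<lambda>j. b (Suc n - j))) =
      binom_sum n (\<lambda>i. a (Suc i) \<otimes> binom_sum i (\<lambda>j. b (Suc (n - j))) \<oplus>
        a (Suc i) \<otimes> binom_sum i (\<lambda>j. b (n - j)))"
    using assms bd inner
    by (intro binom_sum_cong) (auto simp: binom_sum_Suc r_distr)
  also have "\<dots> = newton R (\<lambda>n. a (Suc n)) (\<lambda>n. b (Suc n)) n \<oplus> newton R (\<lambda>n. a (Suc n)) b n"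
    unfolding newton_eq_binom_sum[OF a' b'] newton_eq_binom_sum[OF a' assms(2)] using assms bd
    by (intro binom_sum_add) auto
  finally show ?thesis .
qed

section \<open>The Hurwitz product with a geometric sequence\<close>

text \<open>On exponential generating functions this is multiplication by \<open>exp (r X)\<close>.\<close>

definition exp_twist :: "'a \<Rightarrow> (nat \<Rightarrow> 'a) \<Rightarrow> nat \<Rightarrow> 'a" where
  "exp_twist r a = hurwitz R a (\<lambda>n. r [^] n)"

context
  fixes r :: 'a
  assumes r: "r \<in> carrier R"
begin

lemma exp_twist_closed [simp]: "a \<in> seqs \<Longrightarrow> exp_twist r a \<in> seqs"
  using r by (auto simp: exp_twist_def hurwitz_eq_binom_sum intro!: binom_sum_closed)

lemma exp_twist_0: "a \<in> seqs \<Longrightarrow> exp_twist r a 0 = a 0"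
  using r by (auto simp: exp_twist_def hurwitz_def)

lemma exp_twist_add:
  assumes "a \<in> seqs" "b \<in> seqs"
  shows "exp_twist r (\<lambda>n. a n \<oplus> b n) = (\<lambda>n. exp_twist r a n \<oplus> exp_twist r b n)"
proof
  fix n
  have "(\<lambda>i. a i \<otimes> r [^] (n - i)) \<in> seqs" "(\<lambda>i. b i \<otimes> r [^] (n - i)) \<in> seqs"
    using assms r by auto
  then show "exp_twist r (\<lambda>n. a n \<oplus> b n) n = exp_twist r a n \<oplus> exp_twist r b n"
    using assms r by (simp add: exp_twist_def hurwitz_eq_binom_sum l_distr binom_sum_add)
qed

lemma exp_twist_smult:
  assumes "s \<in> carrier R" "a \<in> seqs"
  shows "exp_twist r (\<lambda>n. s \<otimes> a n) = (\<lambda>n. s \<otimes> exp_twist r a n)"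
proof
  fix n
  have "(\<lambda>i. a i \<otimes> r [^] (n - i)) \<in> seqs" using assms r by auto
  then show "exp_twist r (\<lambda>n. s \<otimes> a n) n = s \<otimes> exp_twist r a n"
    using assms r by (simp add: exp_twist_def hurwitz_eq_binom_sum m_assoc binom_sum_smult)
qed

text \<open>The product rule for \<open>f exp (r X)\<close>: shifting the powers of \<open>r\<close>
  multiplies them by \<open>r\<close>.\<close>

lemma exp_twist_shift:
  assumes "a \<in> seqs"
  shows "(\<lambda>n. exp_twist r a (Suc n)) =
    (\<lambda>n. exp_twist r (\<lambda>n. a (Suc n)) n \<oplus> r \<otimes> exp_twist r a n)"
proof
  fix n
  have s: "(\<lambda>i. a i \<otimes> r [^] (n - i)) \<in> seqs" using assms r by auto
  have "hurwitz R a (\<lambda>n. r [^] Suc n) n = binom_sum n (\<lambda>i. r \<otimes> (a i \<otimes> r [^] (n - i)))"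
    unfolding hurwitz_eq_binom_sum using assms r
    by (intro binom_sum_cong) (auto simp: m_ac)
  also have "\<dots> = r \<otimes> exp_twist r a n"
    unfolding exp_twist_def hurwitz_eq_binom_sum using r s by (rule binom_sum_smult)
  finally show "exp_twist r a (Suc n) = exp_twist r (\<lambda>n. a (Suc n)) n \<oplus> r \<otimes> exp_twist r a n"
    using assms r hurwitz_Suc[of a "\<lambda>n. r [^] n" n] by (auto simp: exp_twist_def)
qed

lemma exp_twist_zero: "exp_twist r (\<lambda>n. \<zero>) = (\<lambda>n. \<zero>)"
proof -
  have z: "(\<lambda>n. \<zero>) \<in> seqs" by auto
  from exp_twist_smult[OF zero_closed this] show ?thesis
    using exp_twist_closed[OF z] by simp
qed

text \<open>By \<open>exp_twist_shift\<close>, the shift of a twisted generator is the twist of a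
  span element plus \<open>r\<close> times the twisted generator, so twisting preserves shift
  stability.\<close>

lemma lin_rec_seqs_exp_twist:
  assumes "a \<in> lin_rec_seqs R"
  shows "exp_twist r a \<in> lin_rec_seqs R"
proof -
  obtain G where G: "finite G" "G \<subseteq> seqs" "\<And>g. g \<in> G \<Longrightarrow> (\<lambda>n. g (Suc n)) \<in> seq_span G"
    "a \<in> seq_span G"
    using assms unfolding lin_rec_seqs_iff_span by blast
  let ?H = "exp_twist r ` G"
  have img: "exp_twist r x \<in> seq_span ?H" if "x \<in> seq_span G" for x
    by (rule seq_span_image[OF that G(2)])
      (auto simp: exp_twist_zero exp_twist_add exp_twist_smult intro: seq_span_base)
  have "(\<lambda>n. exp_twist r g (Suc n)) \<in> seq_span ?H" if "g \<in> G" for g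
    using that G(2) r by (subst exp_twist_shift)
      (auto intro!: seq_span_add seq_span_smult img G(3) intro: seq_span_base)
  then show ?thesis
    unfolding lin_rec_seqs_iff_span using G(1,2) img[OF G(4)]
    by (intro exI[of _ ?H]) auto
qed

end

text \<open>This reflects \<open>exp (r X) exp (s X) = 1\<close>. Induction on the index replaces
  associativity of the Hurwitz product: the inner twist contributes \<open>r a\<close>, the outer
  one \<open>s a\<close>, and these cancel.\<close>

lemma exp_twist_inverse:
  assumes "r \<in> carrier R" "s \<in> carrier R" "r \<oplus> s = \<zero>" "a \<in> seqs"
  shows "exp_twist s (exp_twist r a) = a"
proof
  fix n
  show "exp_twist s (exp_twist r a) n = a n"
    using assms(4)
  proof (induction n arbitrary: a)
    case 0
    then show ?case using assms by (simp add: exp_twist_0)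
  next
    case (Suc n)
    have a': "(\<lambda>n. a (Suc n)) \<in> seqs" using Suc.prems by auto
    have ra: "exp_twist r a \<in> seqs" and ra': "exp_twist r (\<lambda>n. a (Suc n)) \<in> seqs"
      using Suc.prems a' assms by auto
    then have ra'': "(\<lambda>n. r \<otimes> exp_twist r a n) \<in> seqs" using assms by auto
    have "exp_twist s (exp_twist r a) (Suc n) =
        exp_twist s (\<lambda>n. exp_twist r a (Suc n)) n \<oplus> s \<otimes> exp_twist s (exp_twist r a) n"
      using exp_twist_shift[OF assms(2) ra] by meson
    also have "\<dots> = (a (Suc n) \<oplus> r \<otimes> a n) \<oplus> s \<otimes> a n"
      unfolding exp_twist_shift[OF assms(1) Suc.prems] exp_twist_add[OF assms(2) ra' ra'']
        exp_twist_smult[OF assms(2,1) ra]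
      using Suc.IH[OF Suc.prems] Suc.IH[OF a'] by simp
    also have "\<dots> = a (Suc n) \<oplus> (r \<oplus> s) \<otimes> a n"
      using assms(1,2) Suc.prems by (simp add: l_distr a_assoc)
    finally show ?case using assms(3) Suc.prems by simp
  qed
qed

lemma exp_twist_minus_one_shift:
  assumes "a \<in> seqs"
  shows "(\<lambda>n. exp_twist (\<ominus> \<one>) a (Suc n)) = exp_twist (\<ominus> \<one>) (\<lambda>n. a (Suc n) \<oplus> \<ominus> \<one> \<otimes> a n)"
proof -
  have "(\<lambda>n. a (Suc n)) \<in> seqs" "(\<lambda>n. \<ominus> \<one> \<otimes> a n) \<in> seqs" using assms by auto
  with assms show ?thesis
    by (simp add: exp_twist_shift exp_twist_add exp_twist_smult)
qed

lemma exp_twist_hadamard: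
  assumes "a \<in> seqs" "b \<in> seqs"
  shows "exp_twist (\<ominus> \<one>) (\<lambda>n. a n \<otimes> b n) n =
    newton R (exp_twist (\<ominus> \<one>) a) (exp_twist (\<ominus> \<one>) b) n"
  using assms
\<comment> \<open>The sequences are generalized because the Leibniz rule replaces factors by their
  differences.\<close>
proof (induction n arbitrary: a b)
  case 0
  then have "(\<lambda>n. a n \<otimes> b n) \<in> seqs" by auto
  moreover have "exp_twist (\<ominus> \<one>) a \<in> seqs" "exp_twist (\<ominus> \<one>) b \<in> seqs" using 0 by auto
  ultimately show ?case using 0 by (simp add: exp_twist_0 newton_def)
next
  case (Suc n)
  let ?t = "exp_twist (\<ominus> \<one>)"
  define D where "D a = (\<lambda>n. a (Suc n) \<oplus> \<ominus> \<one> \<otimes> a n)" for a :: "nat \<Rightarrow> 'a"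
  have D: "D c \<in> seqs" if "c \<in> seqs" for c using that by (auto simp: D_def)
  have shift: "(\<lambda>n. ?t c (Suc n)) = ?t (D c)" if "c \<in> seqs" for c
    using exp_twist_minus_one_shift[OF that] by (simp add: D_def)
  have s: "(\<lambda>n. x n \<otimes> y n) \<in> seqs" if "x \<in> seqs" "y \<in> seqs" for x y using that by auto
  have s2: "(\<lambda>n. x n \<oplus> y n) \<in> seqs" if "x \<in> seqs" "y \<in> seqs" for x y using that by auto
  note a = Suc.prems(1) and b = Suc.prems(2)
  have "D (\<lambda>n. a n \<otimes> b n) = (\<lambda>n. a n \<otimes> D b n \<oplus> (D a n \<otimes> D b n \<oplus> D a n \<otimes> b n))"
  proof
    fix n
    have [simp]: "a n \<in> carrier R" "b n \<in> carrier R" "a (Suc n) \<in> carrier R"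
      "b (Suc n) \<in> carrier R" using a b by auto
    \<comment> \<open>The Leibniz rule for differences as an identity in four ring elements; primed
      ones stand for values at \<open>Suc n\<close>, the others for values at
      \<open>n\<close>.\<close>
    have "(x' \<otimes> y') \<ominus> (x \<otimes> y) = x \<otimes> (y' \<ominus> y) \<oplus> ((x' \<ominus> x) \<otimes> (y' \<ominus> y) \<oplus> (x' \<ominus> x) \<otimes> y)"
      if "x \<in> carrier R" "y \<in> carrier R" "x' \<in> carrier R" "y' \<in> carrier R" for x y x' y'
      using that by algebra
    from this[of "a n" "b n" "a (Suc n)" "b (Suc n)"]
    show "D (\<lambda>n. a n \<otimes> b n) n = a n \<otimes> D b n \<oplus> (D a n \<otimes> D b n \<oplus> D a n \<otimes> b n)"
      by (simp add: D_def l_minus a_minus_def)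
  qed
  then have "?t (\<lambda>n. a n \<otimes> b n) (Suc n) =
      ?t (\<lambda>n. a n \<otimes> D b n \<oplus> (D a n \<otimes> D b n \<oplus> D a n \<otimes> b n)) n"
    using fun_cong[OF shift[OF s[OF a b]], of n] by simp
  also have "\<dots> = ?t (\<lambda>n. a n \<otimes> D b n) n \<oplus>
      (?t (\<lambda>n. D a n \<otimes> D b n) n \<oplus> ?t (\<lambda>n. D a n \<otimes> b n) n)"
    using a b D s s2 by (simp add: exp_twist_add)
  also have "\<dots> = newton R (?t a) (?t (D b)) n \<oplus>
      (newton R (?t (D a)) (?t (D b)) n \<oplus> newton R (?t (D a)) (?t b) n)"
    using Suc.IH a b D by simp
  also have "\<dots> = newton R (?t a) (?t b) (Suc n)"
    using a b by (simp add: newton_Suc shift)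
  finally show ?case .
qed

section \<open>The two algebras\<close>

lemma lin_rec_seqs_closed: "a \<in> lin_rec_seqs R \<Longrightarrow> a n \<in> carrier R"
  by (simp add: lin_rec_seqs_imp_seqs)

lemma cring_hadamard_algebra: "cring (hadamard_algebra R)"
proof (rule cringI)
  note defs = hadamard_algebra_def seq_add_def hadamard_def lin_rec_seqs_closed
  note closed = lin_rec_seqs_zero lin_rec_seqs_one lin_rec_seqs_add lin_rec_seqs_hadamard
  show "abelian_group (hadamard_algebra R)"
  proof (rule abelian_groupI)
    fix x assume x: "x \<in> carrier (hadamard_algebra R)"
    show "\<exists>y\<in>carrier (hadamard_algebra R). y \<oplus>\<^bsub>hadamard_algebra R\<^esub> x = \<zero>\<^bsub>hadamard_algebra R\<^esub>"
      using x lin_rec_seqs_smult[of "\<ominus> \<one>" x]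
      by (intro bexI[of _ "\<lambda>n. \<ominus> \<one> \<otimes> x n"]) (auto simp: defs l_minus l_neg)
  qed (auto simp: defs a_ac closed intro!: ext)
  show "Group.comm_monoid (hadamard_algebra R)"
    by (rule comm_monoidI) (auto simp: defs m_ac closed)
qed (auto simp: hadamard_algebra_def seq_add_def hadamard_def l_distr
    lin_rec_seqs_closed)

lemma algebra_hadamard: "algebra R (hadamard_algebra R)"
  by (rule algebraI[OF is_cring cring_hadamard_algebra])
    (auto simp: hadamard_algebra_def seq_smult_def seq_add_def hadamard_def
      lin_rec_seqs_smult l_distr r_distr m_assoc lin_rec_seqs_closed)

text \<open>The constant sequence has difference zero, so by
  \<open>exp_twist_minus_one_shift\<close> its image vanishes beyond index 0.\<close>

lemma exp_twist_minus_one_one: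
  "exp_twist (\<ominus> \<one>) (\<lambda>n. \<one>) = (\<lambda>n. if n = 0 then \<one> else \<zero>)"
proof
  fix n
  have one: "(\<lambda>n. \<one>) \<in> seqs" by auto
  have "(\<lambda>n. exp_twist (\<ominus> \<one>) (\<lambda>n. \<one>) (Suc n)) = exp_twist (\<ominus> \<one>) (\<lambda>n. \<zero>)"
    using exp_twist_minus_one_shift[OF one] by (simp add: l_minus r_neg)
  then have "exp_twist (\<ominus> \<one>) (\<lambda>n. \<one>) (Suc n) = \<zero>" for n
    by (simp add: exp_twist_zero fun_eq_iff)
  then show "exp_twist (\<ominus> \<one>) (\<lambda>n. \<one>) n = (if n = 0 then \<one> else \<zero>)"
    by (cases n) (auto simp: exp_twist_0 one)
qed

lemma exp_twist_ring_iso: "exp_twist (\<ominus> \<one>) \<in> ring_iso (hadamard_algebra R) (newton_algebra R)"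
proof (rule ring_iso_memI)
  note W = lin_rec_seqs_imp_seqs
  note defs = hadamard_algebra_def newton_algebra_def seq_add_def hadamard_def
  show "bij_betw (exp_twist (\<ominus> \<one>)) (carrier (hadamard_algebra R)) (carrier (newton_algebra R))"
    by (rule bij_betw_byWitness[where f' = "exp_twist \<one>"])
      (auto simp: defs lin_rec_seqs_exp_twist exp_twist_inverse l_neg r_neg dest: W)
qed (auto simp: hadamard_algebra_def newton_algebra_def seq_add_def hadamard_def
    lin_rec_seqs_exp_twist exp_twist_add exp_twist_minus_one_one exp_twist_hadamard
    intro!: ext dest!: lin_rec_seqs_imp_seqs)

text \<open>The ring laws of the Newton product, associativity included, are transported along
  \<psi> instead of being computed.\<close>

lemma cring_newton_algebra: "cring (newton_algebra R)"
proof -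
  interpret H: cring "hadamard_algebra R" by (rule cring_hadamard_algebra)
  \<comment> \<open>The transported ring has the image of zero as its zero; this identifies it with
    the declared one.\<close>
  have "exp_twist (\<ominus> \<one>) \<zero>\<^bsub>hadamard_algebra R\<^esub> = \<zero>\<^bsub>newton_algebra R\<^esub>"
    by (simp add: hadamard_algebra_def newton_algebra_def exp_twist_zero)
  with H.ring_iso_imp_img_cring[OF exp_twist_ring_iso] show ?thesis by simp
qed

lemma algebra_newton: "algebra R (newton_algebra R)"
proof (rule algebraI[OF is_cring cring_newton_algebra])
  fix r x y
  assume r: "r \<in> carrier R" and "x \<in> carrier (newton_algebra R)" "y \<in> carrier (newton_algebra R)"
  then have x: "x \<in> seqs" and y: "y \<in> seqs"
    by (auto simp: newton_algebra_def dest: lin_rec_seqs_imp_seqs)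
  \<comment> \<open>The ring isomorphism says nothing about scalars; homogeneity in the left factor
    comes from linearity of the outer binomial sum.\<close>
  have "newton R (\<lambda>n. r \<otimes> x n) y n = r \<otimes> newton R x y n" for n
  proof -
    have rx: "(\<lambda>n. r \<otimes> x n) \<in> seqs" and yn: "(\<lambda>j. y (n - j)) \<in> seqs" using r x y by auto
    then have xy: "(\<lambda>i. x i \<otimes> binom_sum i (\<lambda>j. y (n - j))) \<in> seqs" using x by auto
    show ?thesis
      unfolding newton_eq_binom_sum[OF rx y] newton_eq_binom_sum[OF x y]
        binom_sum_smult[OF r xy, symmetric]
      using r x yn by (intro binom_sum_cong) (auto simp: m_assoc)
  qed
  then show "(r \<odot>\<^bsub>newton_algebra R\<^esub> x) \<otimes>\<^bsub>newton_algebra R\<^esub> y =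
      r \<odot>\<^bsub>newton_algebra R\<^esub> (x \<otimes>\<^bsub>newton_algebra R\<^esub> y)"
    by (auto simp: newton_algebra_def seq_smult_def)
qed (auto simp: newton_algebra_def seq_smult_def seq_add_def
      lin_rec_seqs_smult l_distr r_distr m_assoc lin_rec_seqs_closed)

lemma exp_twist_algebra_iso:
  "exp_twist (\<ominus> \<one>) \<in> algebra_iso R (hadamard_algebra R) (newton_algebra R)"
  using exp_twist_ring_iso
  by (auto simp: algebra_iso_def hadamard_algebra_def newton_algebra_def seq_smult_def
      exp_twist_smult dest: lin_rec_seqs_imp_seqs)

end

theorem theorem13:
  fixes R :: "('a, 'm) ring_scheme"
  assumes "cring R"
  shows "algebra R (hadamard_algebra R) \<and> algebra R (newton_algebra R) \<and>
    algebras_isomorphic R (hadamard_algebra R) (newton_algebra R) \<and>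
    (\<lambda>a. hurwitz R a (alt_seq R)) \<in> algebra_iso R (hadamard_algebra R) (newton_algebra R)"
proof -
  interpret cring R by fact
  have "(\<lambda>a. hurwitz R a (alt_seq R)) \<in> algebra_iso R (hadamard_algebra R) (newton_algebra R)"
    using exp_twist_algebra_iso by (simp add: exp_twist_def[abs_def] alt_seq_def)
  with algebra_hadamard algebra_newton show ?thesis
    unfolding algebras_isomorphic_def by blast
qed

end
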